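(* Let $m,d\in\mathbb{N}$ with $m\ge d\ge 2$, let $0\le\theta\le\frac{\pi}{2}$, and let $N=m^d$. Let $P_{\Omega^{*}_{\sim}}$ be the stratified random point set associated with the local convex partition $\Omega^{*}_{\sim}$ of $[0,1]^d$ with parameter $\theta$. Then $$\mathbb{E}\big(L_2^2(D_N,P_{\Omega^{*}_{\sim}})\big)\le \frac{d}{N^{1+\frac1d}}+\frac{1}{N^3}\cdot\frac{1}{3^{d-2}}\cdot P(\theta),$$ where $$P(\theta)=\begin{cases}\frac{2}{45}\tan^3\theta+\frac{2}{15}\tan^2\theta-\frac{\tan\theta}{6}, & 0\le\theta<\arctan\frac12,\\[2pt] -\frac{2}{45}, & \theta=\arctan\frac12,\\[2pt] -\frac{1}{24\tan\theta}+\frac{1}{120\tan^2\theta}+\frac{1}{1440\tan^3\theta}, & \arctan\frac12<\theta\le\frac{\pi}{2},\end{cases}$$ with $\frac{1}{\tan\theta}$ read as $\cot\theta$ (so it equals $0$ at $\theta=\frac\pi2$).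
   Context: **$L_2$-discrepancy.** For points $t_1,\dots,t_N\in[0,1]^d$ and $P=\{t_1,\dots,t_N\}$, $$L_2(D_N,P)=\Big(\int_{[0,1]^d}\Big|\lambda([0,z))-\frac1N\sum_{i=1}^N\mathbf 1_{[0,z)}(t_i)\Big|^2dz\Big)^{1/2},$$ where $\lambda$ is Lebesgue measure and $[0,z)=\prod_{i=1}^d[0,z_i)$. $L_2^2(D_N,P)$ denotes the square of this quantity. ($D_N$ is only part of the notation.) **Stratified point sets.** For a partition $\Omega=(\Omega_1,\dots,\Omega_N)$ of $[0,1]^d$ (up to null sets) into $N$ sets of volume $1/N$, the stratified random point set $P_\Omega$ consists of $N$ independent random points, the $i$-th one uniformly distributed in $\Omega_i$; $\mathbb{E}$ is expectation with respect to these points. **Local convex partition $\Omega^{*}_{\sim}$ with parameter $\theta\in[0,\frac\pi2]$.** Start from the partition of $[0,1]^d$ into the $N=m^d$ axis-parallel cubes of side $\frac1m$ of the regular grid. Let $a_1=\frac{m-2}{m}$, $a_i=\frac{m-1}{m}$ for $2\le i\le d$, $b=\frac1m$, and let $I_d=[a_1,a_1+2b]\times\prod_{i=2}^d[a_i,a_i+b]$, which is the union of two grid cubes. Let $Q_3,\dots,Q_N$ be the remaining $N-2$ grid cubes. Then $\Omega^{*}_{\sim}=(\Omega^{*}_{1,\sim},\Omega^{*}_{2,\sim},Q_3,\dots,Q_N)$, where $I_d$ is divided into two convex parts of equal volume by cutting the rectangle $[a_1,a_1+2b]\times[a_2,a_2+b]$ (the first two coordinates) along the line through its center $(a_1+b,a_2+\frac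 b2)$ that makes angle $\theta$ with the horizontal and slopes downwards (slope $-\tan\theta$; vertical if $\theta=\frac\pi2$). Explicitly, $$\Omega^{*}_{1,\sim}=\{x\in I_d:\ (x_1-a_1-b)\sin\theta+(x_2-a_2-\tfrac b2)\cos\theta\le 0\},$$ and $\Omega^{*}_{2,\sim}$ is the closure of $I_d\setminus\Omega^{*}_{1,\sim}$. *)

theory Defs
  imports "HOL-Probability.Probability"
begin

text \<open>
  Points of d-dimensional real space are the extensional functions on \<open>{1..d}\<close>, so that
  coordinates are numbered \<open>1, \<dots>, d\<close>. Lebesgue measure is the product of \<open>d\<close> copies of
  one-dimensional (Borel) Lebesgue measure, and the Euclidean topology is the product topology
  \<open>powertop_real {1..d}\<close>.
\<close>

abbreviation lborel_pow :: "nat \<Rightarrow> (nat \<Rightarrow> real) measure" where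
  "lborel_pow d \<equiv> (\<Pi>\<^sub>M i\<in>{1..d}. lborel)"

definition unit_cube :: "nat \<Rightarrow> (nat \<Rightarrow> real) set" where
  "unit_cube d = (\<Pi>\<^sub>E i\<in>{1..d}. {0..1})"

definition anchored_box :: "nat \<Rightarrow> (nat \<Rightarrow> real) \<Rightarrow> (nat \<Rightarrow> real) set" where
  "anchored_box d z = (\<Pi>\<^sub>E i\<in>{1..d}. {0..<z i})"

text \<open>The point set is given as the family \<open>t 1, \<dots>, t N\<close>, i.e. counted with multiplicity.\<close>

definition L2_discrepancy :: "nat \<Rightarrow> nat \<Rightarrow> (nat \<Rightarrow> nat \<Rightarrow> real) \<Rightarrow> real" where
  "L2_discrepancy d N t =
     sqrt (LINT z:unit_cube d|lborel_pow d.
       \<bar>measure (lborel_pow d) (anchored_box d z)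
          - 1 / real N * (\<Sum>i=1..N. indicator (anchored_box d z) (t i))\<bar>\<^sup>2)"

definition stratified_points ::
  "'w measure \<Rightarrow> nat \<Rightarrow> nat \<Rightarrow> (nat \<Rightarrow> (nat \<Rightarrow> real) set) \<Rightarrow> (nat \<Rightarrow> 'w \<Rightarrow> nat \<Rightarrow> real) \<Rightarrow> bool" where
  "stratified_points M d N \<Omega> X \<longleftrightarrow>
     prob_space M \<and>
     prob_space.indep_vars M (\<lambda>_. lborel_pow d) X {1..N} \<and>
     (\<forall>i\<in>{1..N}. distr M (lborel_pow d) (X i) = uniform_measure (lborel_pow d) (\<Omega> i))"

definition grid_cubes :: "nat \<Rightarrow> nat \<Rightarrow> (nat \<Rightarrow> real) set set" where
  "grid_cubes m d =
     (\<lambda>k. \<Pi>\<^sub>E i\<in>{1..d}. {real (k i) / real m .. (real (k i) + 1) / real m})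
       ` ({1..d} \<rightarrow>\<^sub>E {..<m})"

definition corner :: "nat \<Rightarrow> nat \<Rightarrow> real" where
  "corner m i = (if i = 1 then (real m - 2) / real m else (real m - 1) / real m)"

definition merged_box :: "nat \<Rightarrow> nat \<Rightarrow> (nat \<Rightarrow> real) set" where
  "merged_box m d =
     (\<Pi>\<^sub>E i\<in>{1..d}. {corner m i .. corner m i + (if i = 1 then 2 else 1) * (1 / real m)})"

definition remaining_cubes :: "nat \<Rightarrow> nat \<Rightarrow> (nat \<Rightarrow> real) set set" where
  "remaining_cubes m d = {Q \<in> grid_cubes m d. \<not> Q \<subseteq> merged_box m d}"

definition lower_part :: "nat \<Rightarrow> nat \<Rightarrow> real \<Rightarrow> (nat \<Rightarrow> real) set" where
  "lower_part m d \<theta> =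
     {x \<in> merged_box m d.
        (x 1 - corner m 1 - 1 / real m) * sin \<theta>
          + (x 2 - corner m 2 - (1 / real m) / 2) * cos \<theta> \<le> 0}"

definition upper_part :: "nat \<Rightarrow> nat \<Rightarrow> real \<Rightarrow> (nat \<Rightarrow> real) set" where
  "upper_part m d \<theta> = powertop_real {1..d} closure_of (merged_box m d - lower_part m d \<theta>)"

text \<open>
  The remaining \<open>m ^ d - 2\<close> grid cubes have no prescribed order: any enumeration
  \<open>\<Omega> 3, \<dots>, \<Omega> (m ^ d)\<close> of them is allowed.
\<close>

definition local_convex_partition ::
  "nat \<Rightarrow> nat \<Rightarrow> real \<Rightarrow> (nat \<Rightarrow> (nat \<Rightarrow> real) set) \<Rightarrow> bool" where
  "local_convex_partition m d \<theta> \<Omega> \<longleftrightarrow>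
     \<Omega> 1 = lower_part m d \<theta> \<and>
     \<Omega> 2 = upper_part m d \<theta> \<and>
     bij_betw \<Omega> {3..m ^ d} (remaining_cubes m d)"

text \<open>\<open>1 / tan \<theta>\<close> is written \<open>cot \<theta>\<close>, which is \<open>0\<close> at \<open>\<theta> = pi / 2\<close>.\<close>

definition P_theta :: "real \<Rightarrow> real" where
  "P_theta \<theta> =
     (if \<theta> < arctan (1 / 2) then 2 / 45 * tan \<theta> ^ 3 + 2 / 15 * tan \<theta> ^ 2 - tan \<theta> / 6
      else if \<theta> = arctan (1 / 2) then - (2 / 45)
      else - (1 / 24 * cot \<theta>) + 1 / 120 * cot \<theta> ^ 2 + 1 / 1440 * cot \<theta> ^ 3)"

end

theory Submission
  imports Defs
begin

text \<open>
  For a fixed \<open>z\<close> let \<open>p i = N \<lambda>(\<Omega> i \<inter> [0, z))\<close>, the probability that the \<open>i\<close>-th point falls into the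
  anchored box \<open>[0, z)\<close>. The strata have volume \<open>1 / N\<close> and partition the unit cube up to null sets,
  so the number of points in \<open>[0, z)\<close> has mean \<open>N \<lambda>([0, z))\<close>. The mean square of the local discrepancy
  at \<open>z\<close> is therefore the variance \<open>(\<Sum>i. p i (1 - p i)) / N\<^sup>2\<close> (\<open>expectation_square_count_error\<close>), and
  the mean square \<open>L\<^sub>2\<close>-discrepancy is the integral of this variance over \<open>z\<close>, by Fubini's theorem
  (\<open>expectation_L2_discrepancy_le\<close>).

  A stratum contributes to the variance only if the boundary of \<open>[0, z)\<close> cuts it. The \<open>d\<close> faces of
  \<open>[0, z)\<close> cut at most \<open>d m ^ (d - 1)\<close> grid cubes (\<open>card_cut_grid_indices\<close>), the two convex parts may be
  cut as well, and \<open>p (1 - p) \<le> 1 / 4\<close>. With \<open>N = m ^ d\<close> and \<open>d m ^ (d - 1) \<ge> 4\<close> this gives, for every \<open>z\<close>,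
  the bound \<open>(d m ^ (d - 1) + 2) / (4 N\<^sup>2) \<le> (3 / 8) d / N ^ (1 + 1 / d)\<close>, with a leading constant
  smaller than the one claimed.

  The correction term is where \<open>\<theta>\<close> enters the claim. It is of the order \<open>1 / N ^ 3\<close>, and
  \<open>P_theta \<theta> \<ge> - (1 / 12)\<close> (\<open>P_theta_lower_bound\<close>), so the remaining \<open>(5 / 8) d / N ^ (1 + 1 / d)\<close> exceeds it
  in absolute value whenever it is negative. Thus the angle is absorbed by the slack in the leading
  term, and the two convex parts enter only through the properties that make the sample unbiased: both
  have volume \<open>1 / N\<close>, by a point symmetry (\<open>measure_upper_part_eq_lower_part\<close>), and they overlap in
  a null subset of the cutting hyperplane (\<open>AE_tilt_nonzero\<close>).
\<close>

section \<open>Variance of the number of sample points in a set\<close>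

text \<open>
  The mixed terms of the expanded square vanish: by independence the expectation of a product of two
  different centred variables is the product of their expectations, which is \<open>0\<close>.
\<close>

lemma (in prob_space) expectation_square_sum_indep_vars:
  fixes Y :: "'i \<Rightarrow> 'a \<Rightarrow> real"
  assumes I: "finite I" and indep: "indep_vars (\<lambda>_. borel) Y I"
    and int: "\<And>i. i \<in> I \<Longrightarrow> integrable M (Y i)"
    and int2: "\<And>i. i \<in> I \<Longrightarrow> integrable M (\<lambda>\<omega>. (Y i \<omega>)\<^sup>2)"
    and centred: "\<And>i. i \<in> I \<Longrightarrow> expectation (Y i) = 0"
  shows "expectation (\<lambda>\<omega>. (\<Sum>i\<in>I. Y i \<omega>)\<^sup>2) = (\<Sum>i\<in>I. expectation (\<lambda>\<omega>. (Y i \<omega>)\<^sup>2))"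
proof -
  have pair: "integrable M (\<lambda>\<omega>. Y i \<omega> * Y j \<omega>) \<and> expectation (\<lambda>\<omega>. Y i \<omega> * Y j \<omega>) = 0"
    if "i \<in> I" "j \<in> I" "i \<noteq> j" for i j
  proof -
    have ind: "indep_vars (\<lambda>_. borel) Y {i, j}"
      using indep_vars_subset[OF indep] that by auto
    have int': "integrable M (Y k)" if "k \<in> {i, j}" for k
      using int that \<open>i \<in> I\<close> \<open>j \<in> I\<close> by auto
    show ?thesis
      using indep_vars_lebesgue_integral[OF _ ind int'] indep_vars_integrable[OF _ ind int']
        centred[OF \<open>i \<in> I\<close>] that by simp
  qed
  have int_pair: "integrable M (\<lambda>\<omega>. Y i \<omega> * Y j \<omega>)" if "i \<in> I" "j \<in> I" for i j
    using pair[OF that] int2[OF that(1)] by (cases "i = j") (auto simp: power2_eq_square)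
  have "expectation (\<lambda>\<omega>. (\<Sum>i\<in>I. Y i \<omega>)\<^sup>2)
      = expectation (\<lambda>\<omega>. \<Sum>i\<in>I. \<Sum>j\<in>I. Y i \<omega> * Y j \<omega>)"
    by (simp add: power2_eq_square sum_product)
  also have "\<dots> = (\<Sum>i\<in>I. \<Sum>j\<in>I. expectation (\<lambda>\<omega>. Y i \<omega> * Y j \<omega>))"
    using int_pair by (simp add: Bochner_Integration.integral_sum)
  also have "\<dots> = (\<Sum>i\<in>I. \<Sum>j\<in>I. if j = i then expectation (\<lambda>\<omega>. (Y i \<omega>)\<^sup>2) else 0)"
    using pair by (intro sum.cong refl) (auto simp: power2_eq_square)
  also have "\<dots> = (\<Sum>i\<in>I. expectation (\<lambda>\<omega>. (Y i \<omega>)\<^sup>2))"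
    using I by simp
  finally show ?thesis .
qed

text \<open>
  The number of sample points in \<open>B\<close> is a sum of independent Bernoulli variables, so its variance
  is the sum of the Bernoulli variances. The sampling distributions may differ from one index to the
  next, as they do for stratified points.
\<close>

lemma (in prob_space) expectation_square_count_error:
  assumes I: "finite I" and indep: "indep_vars (\<lambda>_. L) X I" and B: "B \<in> sets L"
  defines "p \<equiv> \<lambda>i. measure (distr M L (X i)) B"
  shows "expectation (\<lambda>\<omega>. ((\<Sum>i\<in>I. p i) - (\<Sum>i\<in>I. indicator B (X i \<omega>)))\<^sup>2)
       = (\<Sum>i\<in>I. p i * (1 - p i))"
proof -
  have rv[measurable]: "X i \<in> measurable M L" if "i \<in> I" for i
    using indep that by (auto simp: indep_vars_def)
  define Y where "Y i \<omega> = p i - indicator B (X i \<omega>)" for i \<omega>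
  have Y_meas: "(\<lambda>x. p i - indicator B x) \<in> borel_measurable L" for i
    using B by measurable
  have ind: "indep_vars (\<lambda>_. borel) Y I"
    unfolding Y_def by (rule indep_vars_compose2[OF indep]) (rule Y_meas)
  have exp_ind: "expectation (\<lambda>\<omega>. indicator B (X i \<omega>)) = p i"
    and int_ind: "integrable M (\<lambda>\<omega>. indicator B (X i \<omega>) :: real)" if "i \<in> I" for i
  proof -
    have eq: "indicator B (X i \<omega>) = (indicator (X i -` B \<inter> space M) \<omega> :: real)" if "\<omega> \<in> space M" for \<omega>
      using that by (auto simp: indicator_def)
    have meas: "X i -` B \<inter> space M \<in> sets M"
      using rv[OF that] B by (rule measurable_sets)
    show "expectation (\<lambda>\<omega>. indicator B (X i \<omega>)) = p i"
      using rv[OF that] B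
      by (simp add: eq p_def measure_distr cong: Bochner_Integration.integral_cong)
    have "integrable M (indicator (X i -` B \<inter> space M) :: 'a \<Rightarrow> real)"
      using meas by (intro integrable_real_indicator) (auto simp: emeasure_eq_measure)
    then show "integrable M (\<lambda>\<omega>. indicator B (X i \<omega>) :: real)"
      by (simp add: eq cong: Bochner_Integration.integrable_cong)
  qed
  have sq: "(Y i \<omega>)\<^sup>2 = (p i)\<^sup>2 + (1 - 2 * p i) * indicator B (X i \<omega>)" for i \<omega>
    by (auto simp: Y_def indicator_def power2_eq_square algebra_simps)
  have "expectation (\<lambda>\<omega>. (\<Sum>i\<in>I. Y i \<omega>)\<^sup>2) = (\<Sum>i\<in>I. expectation (\<lambda>\<omega>. (Y i \<omega>)\<^sup>2))"
  proof (rule expectation_square_sum_indep_vars[OF I ind])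
    fix i assume i: "i \<in> I"
    show "integrable M (Y i)" "integrable M (\<lambda>\<omega>. (Y i \<omega>)\<^sup>2)"
      using int_ind[OF i] by (simp_all add: sq) (simp add: Y_def[abs_def])
    show "expectation (Y i) = 0"
      using int_ind[OF i] exp_ind[OF i] by (simp add: Y_def[abs_def] prob_space)
  qed
  also have "\<dots> = (\<Sum>i\<in>I. p i * (1 - p i))"
  proof (intro sum.cong refl)
    fix i assume "i \<in> I"
    then have "expectation (\<lambda>\<omega>. (Y i \<omega>)\<^sup>2) = (p i)\<^sup>2 + (1 - 2 * p i) * p i"
      using int_ind[of i] exp_ind[of i] by (simp add: sq prob_space)
    then show "expectation (\<lambda>\<omega>. (Y i \<omega>)\<^sup>2) = p i * (1 - p i)"
      by (simp add: power2_eq_square algebra_simps)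
  qed
  finally show ?thesis
    by (simp add: Y_def sum_subtractf)
qed

section \<open>Null sets and reflections in product Lebesgue measure\<close>

text \<open>
  Tonelli, integrating over the coordinate \<open>j\<close> first. A hyperplane meets every line in a direction
  not parallel to it in one point, so this shows that hyperplanes are null sets.
\<close>

lemma (in product_sigma_finite) null_sets_PiM_if_lines_null:
  assumes I: "finite I" "j \<in> I" and H: "H \<in> sets (Pi\<^sub>M I M)"
    and lines: "\<And>x. {y. x(j := y) \<in> H} \<in> null_sets (M j)"
  shows "H \<in> null_sets (Pi\<^sub>M I M)"
proof -
  have ins: "insert j (I - {j}) = I"
    using I by auto
  have "emeasure (Pi\<^sub>M I M) H = (\<integral>\<^sup>+ x. indicator H x \<partial>Pi\<^sub>M (insert j (I - {j})) M)"
    unfolding ins using H by simp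
  also have "\<dots> = (\<integral>\<^sup>+ x. (\<integral>\<^sup>+ y. indicator H (x(j := y)) \<partial>M j) \<partial>Pi\<^sub>M (I - {j}) M)"
  proof (rule product_nn_integral_insert)
    show "indicator H \<in> borel_measurable (Pi\<^sub>M (insert j (I - {j})) M)"
      unfolding ins using H by simp
  qed (use I in auto)
  also have "\<dots> = (\<integral>\<^sup>+ x. 0 \<partial>Pi\<^sub>M (I - {j}) M)"
  proof (intro nn_integral_cong)
    fix x
    have "(\<integral>\<^sup>+ y. indicator H (x(j := y)) \<partial>M j) = (\<integral>\<^sup>+ y. indicator {y. x(j := y) \<in> H} y \<partial>M j)"
      by (auto simp: indicator_def intro!: nn_integral_cong)
    also have "\<dots> = 0"
      using lines[of x] by (simp add: null_setsD2 null_setsD1)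
    finally show "(\<integral>\<^sup>+ y. indicator H (x(j := y)) \<partial>M j) = 0" .
  qed
  finally show ?thesis
    using H by auto
qed

lemma product_sigma_finite_lborel: "product_sigma_finite (\<lambda>_. lborel :: real measure)"
  by (simp add: product_sigma_finite_def sigma_finite_lborel)

text \<open>
  A product measure is determined by its values on boxes, and a point reflection acts on a box
  by a reflection in each coordinate, where one-dimensional Lebesgue measure is invariant. The
  point \<open>c / 2\<close> is the centre of the reflection.
\<close>

lemma distr_reflect_PiM_lborel:
  fixes c :: "'i \<Rightarrow> real"
  assumes I: "finite I"
  shows "distr (Pi\<^sub>M I (\<lambda>_. lborel)) (Pi\<^sub>M I (\<lambda>_. lborel)) (\<lambda>x. \<lambda>i\<in>I. c i - x i)
       = Pi\<^sub>M I (\<lambda>_. lborel :: real measure)"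
proof -
  interpret product_sigma_finite "\<lambda>_. lborel :: real measure"
    by (rule product_sigma_finite_lborel)
  let ?T = "\<lambda>x. \<lambda>i\<in>I. c i - x i"
  have T[measurable]: "?T \<in> measurable (Pi\<^sub>M I (\<lambda>_. lborel)) (Pi\<^sub>M I (\<lambda>_. lborel))"
    by measurable
  have one_dim: "emeasure lborel ((\<lambda>y. a - y) -` S) = emeasure lborel S"
    and one_dim_sets: "(\<lambda>y. a - y) -` S \<in> sets borel"
    if "S \<in> sets borel" for a :: real and S
  proof -
    have "(lborel :: real measure) = density (distr lborel borel (\<lambda>x. a + (- 1) * x)) (\<lambda>_. ennreal \<bar>- 1\<bar>)"
      by (rule lborel_real_affine) simp
    then have *: "(lborel :: real measure) = distr lborel borel (\<lambda>x. a - x)"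
      by (simp add: density_1)
    show "(\<lambda>y. a - y) -` S \<in> sets borel"
      using that by (auto intro: measurable_sets_borel[OF _ that])
    show "emeasure lborel ((\<lambda>y. a - y) -` S) = emeasure lborel S"
      using that by (subst (2) *) (simp add: emeasure_distr)
  qed
  show ?thesis
  proof (rule PiM_eqI)
    fix A :: "'i \<Rightarrow> real set" assume A: "\<And>i. i \<in> I \<Longrightarrow> A i \<in> sets lborel"
    have "emeasure (distr (Pi\<^sub>M I (\<lambda>_. lborel)) (Pi\<^sub>M I (\<lambda>_. lborel)) ?T) (Pi\<^sub>E I A)
        = emeasure (Pi\<^sub>M I (\<lambda>_. lborel)) (?T -` Pi\<^sub>E I A \<inter> space (Pi\<^sub>M I (\<lambda>_. lborel)))"
      using A I by (intro emeasure_distr T) auto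
    also have "?T -` Pi\<^sub>E I A \<inter> space (Pi\<^sub>M I (\<lambda>_. lborel)) = Pi\<^sub>E I (\<lambda>i. (\<lambda>y. c i - y) -` A i)"
      by (auto simp: space_PiM PiE_iff)
    also have "emeasure (Pi\<^sub>M I (\<lambda>_. lborel)) \<dots> = (\<Prod>i\<in>I. emeasure lborel (A i))"
      using A I by (subst emeasure_PiM) (auto simp: one_dim one_dim_sets)
    finally show "emeasure (distr (Pi\<^sub>M I (\<lambda>_. lborel)) (Pi\<^sub>M I (\<lambda>_. lborel)) ?T) (Pi\<^sub>E I A)
        = (\<Prod>i\<in>I. emeasure lborel (A i))" .
  qed (use I in auto)
qed

section \<open>Volumes of grid cubes in anchored boxes\<close>

text \<open>
  The length of \<open>[a, b] \<inter> [0, t)\<close> for \<open>0 \<le> a \<le> b\<close>. Volumes of boxes cut by an anchored box are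
  products of such lengths, and these lengths add up along consecutive intervals, so
  volume identities for boxes reduce to one dimension.
\<close>

definition overlap :: "real \<Rightarrow> real \<Rightarrow> real \<Rightarrow> real" where
  "overlap a b t = max 0 (min t b - a)"

definition grid_cube :: "nat \<Rightarrow> nat \<Rightarrow> (nat \<Rightarrow> nat) \<Rightarrow> (nat \<Rightarrow> real) set" where
  "grid_cube m d k = (\<Pi>\<^sub>E i\<in>{1..d}. {real (k i) / real m .. (real (k i) + 1) / real m})"

definition grid_indices :: "nat \<Rightarrow> nat \<Rightarrow> (nat \<Rightarrow> nat) set" where
  "grid_indices m d = {1..d} \<rightarrow>\<^sub>E {..<m}"

lemma measure_Icc_Int_anchored:
  assumes "0 \<le> a"
  shows "measure lborel ({a..b} \<inter> {0..<t}) = overlap a b t"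
proof -
  have "{a..b} \<inter> {0..<t} = (if b < t then {a..b} else {a..<t})"
    using assms by auto
  moreover have "measure lborel {a..<t} = max 0 (t - a)"
    by (cases "a \<le> t") auto
  moreover have "measure lborel {a..b} = max 0 (b - a)"
    by (cases "a \<le> b") auto
  ultimately show ?thesis
    by (auto simp: overlap_def)
qed

lemma overlap_append:
  assumes "a \<le> b" "b \<le> c"
  shows "overlap a b t + overlap b c t = overlap a c t"
  using assms by (auto simp: overlap_def)

lemma sum_overlap_grid:
  assumes "m > 0" "0 \<le> t" "t \<le> 1"
  shows "(\<Sum>j<m. overlap (real j / real m) ((real j + 1) / real m) t) = t"
proof -
  have "(\<Sum>j<n. overlap (real j / real m) ((real j + 1) / real m) t) = overlap 0 (real n / real m) t" for n
  proof (induction n)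
    case (Suc n)
    have "overlap 0 (real n / real m) t + overlap (real n / real m) ((real n + 1) / real m) t
        = overlap 0 ((real n + 1) / real m) t"
      using assms by (intro overlap_append) (auto simp: divide_right_mono)
    then show ?case
      using Suc by (simp add: add.commute)
  qed (use assms in \<open>auto simp: overlap_def\<close>)
  from this[of m] show ?thesis
    using assms by (simp add: overlap_def)
qed

lemma
  assumes A: "\<And>i. i \<in> {1..d} \<Longrightarrow> A i \<in> fmeasurable (lborel :: real measure)"
  shows PiE_fmeasurable: "Pi\<^sub>E {1..d} A \<in> fmeasurable (lborel_pow d)"
    and measure_lborel_pow_PiE:
      "measure (lborel_pow d) (Pi\<^sub>E {1..d} A) = (\<Prod>i\<in>{1..d}. measure lborel (A i))"
proof -
  interpret product_sigma_finite "\<lambda>_::nat. lborel :: real measure"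
    by (rule product_sigma_finite_lborel)
  have A_sets: "A i \<in> sets lborel" if "i \<in> {1..d}" for i
    using A[OF that] by auto
  have em: "emeasure lborel (A i) = ennreal (measure lborel (A i))" if "i \<in> {1..d}" for i
    using A[OF that] by (simp add: emeasure_eq_measure2)
  have "emeasure (lborel_pow d) (Pi\<^sub>E {1..d} A) = (\<Prod>i\<in>{1..d}. ennreal (measure lborel (A i)))"
    using A_sets by (subst emeasure_PiM) (auto simp: em intro!: prod.cong)
  also have "\<dots> = ennreal (\<Prod>i\<in>{1..d}. measure lborel (A i))"
    by (simp add: prod_ennreal)
  finally have *: "emeasure (lborel_pow d) (Pi\<^sub>E {1..d} A) = ennreal (\<Prod>i\<in>{1..d}. measure lborel (A i))" .
  have sets: "Pi\<^sub>E {1..d} A \<in> sets (lborel_pow d)"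
    using A_sets by (intro sets_PiM_I_finite) auto
  show "Pi\<^sub>E {1..d} A \<in> fmeasurable (lborel_pow d)"
    using * sets by (intro fmeasurableI) auto
  show "measure (lborel_pow d) (Pi\<^sub>E {1..d} A) = (\<Prod>i\<in>{1..d}. measure lborel (A i))"
    using * by (simp add: measure_def prod_nonneg)
qed

lemma Icc_fmeasurable [simp, intro]: "{a..b} \<in> fmeasurable (lborel :: real measure)"
  by (auto intro!: fmeasurableI simp: emeasure_lborel_Icc_eq)

lemma Ico_fmeasurable [simp, intro]: "{a..<b} \<in> fmeasurable (lborel :: real measure)"
  by (rule fmeasurableI2[OF Icc_fmeasurable[of a b]]) auto

lemma anchored_box_fmeasurable: "anchored_box d z \<in> fmeasurable (lborel_pow d)"
  unfolding anchored_box_def by (rule PiE_fmeasurable) auto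

lemma measure_anchored_box:
  assumes "z \<in> unit_cube d"
  shows "measure (lborel_pow d) (anchored_box d z) = (\<Prod>i\<in>{1..d}. z i)"
  using assms unfolding anchored_box_def unit_cube_def
  by (subst measure_lborel_pow_PiE) (auto simp: PiE_iff intro!: prod.cong)

lemma measure_Icc_box_Int_anchored_box:
  assumes "\<And>i. i \<in> {1..d} \<Longrightarrow> 0 \<le> a i"
  shows "measure (lborel_pow d) ((\<Pi>\<^sub>E i\<in>{1..d}. {a i..b i}) \<inter> anchored_box d z)
       = (\<Prod>i\<in>{1..d}. overlap (a i) (b i) (z i))"
  using assms unfolding anchored_box_def PiE_Int
  by (subst measure_lborel_pow_PiE) (auto simp: measure_Icc_Int_anchored intro!: prod.cong fmeasurable.Int)

lemma grid_cubes_eq: "grid_cubes m d = grid_cube m d ` grid_indices m d"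
  by (simp add: grid_cubes_def grid_cube_def grid_indices_def)

lemma finite_grid_indices [simp]: "finite (grid_indices m d)"
  by (simp add: grid_indices_def finite_PiE)

lemma grid_cube_fmeasurable: "grid_cube m d k \<in> fmeasurable (lborel_pow d)"
  unfolding grid_cube_def by (rule PiE_fmeasurable) auto

lemma measure_grid_cube: "m > 0 \<Longrightarrow> measure (lborel_pow d) (grid_cube m d k) = 1 / real (m ^ d)"
  unfolding grid_cube_def
  by (subst measure_lborel_pow_PiE) (auto simp: divide_simps power_one_over)

lemma measure_grid_cube_Int_anchored_box:
  "measure (lborel_pow d) (grid_cube m d k \<inter> anchored_box d z)
     = (\<Prod>i\<in>{1..d}. overlap (real (k i) / real m) ((real (k i) + 1) / real m) (z i))"
  unfolding grid_cube_def by (rule measure_Icc_box_Int_anchored_box) auto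

text \<open>
  Distributivity: the sum over all multi-indices of a product over the coordinates is the product over
  the coordinates of the one-dimensional sums, which are the lengths \<open>z i\<close>.
\<close>

lemma sum_measure_grid_cube_Int_anchored_box:
  assumes "m > 0" and z: "z \<in> unit_cube d"
  shows "(\<Sum>k\<in>grid_indices m d. measure (lborel_pow d) (grid_cube m d k \<inter> anchored_box d z))
       = measure (lborel_pow d) (anchored_box d z)"
proof -
  have "(\<Sum>k\<in>grid_indices m d. measure (lborel_pow d) (grid_cube m d k \<inter> anchored_box d z))
      = (\<Prod>i\<in>{1..d}. \<Sum>j<m. overlap (real j / real m) ((real j + 1) / real m) (z i))"
    unfolding measure_grid_cube_Int_anchored_box grid_indices_def by (subst prod_sum_PiE) auto
  also have "\<dots> = (\<Prod>i\<in>{1..d}. z i)"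
    using assms by (intro prod.cong refl sum_overlap_grid) (auto simp: unit_cube_def PiE_iff)
  finally show ?thesis
    unfolding measure_anchored_box[OF z] .
qed

lemma inj_on_grid_cube:
  assumes "m > 0"
  shows "inj_on (grid_cube m d) (grid_indices m d)"
proof (rule inj_onI)
  fix k l assume k: "k \<in> grid_indices m d" and l: "l \<in> grid_indices m d"
    and eq: "grid_cube m d k = grid_cube m d l"
  show "k = l"
  proof (rule PiE_ext[OF k[unfolded grid_indices_def] l[unfolded grid_indices_def]])
    fix i assume i: "i \<in> {1..d}"
    have ne: "{real n / real m..(real n + 1) / real m} \<noteq> {}" for n
      using assms by (auto simp: divide_right_mono)
    have "{real (k i) / real m..(real (k i) + 1) / real m} = {real (l i) / real m..(real (l i) + 1) / real m}"
      using eq i ne unfolding grid_cube_def by (subst (asm) PiE_eq_iff_not_empty) (auto simp del: atLeastatMost_empty_iff2)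
    then show "k i = l i"
      using assms ne[of "k i"] by (auto simp: Icc_eq_Icc divide_right_mono)
  qed
qed

text \<open>
  The two cubes whose union is the merged box: the one at the corner \<open>(1, \<dots>, 1)\<close> and its neighbour
  in the first direction.
\<close>

definition corner_index :: "nat \<Rightarrow> nat \<Rightarrow> nat \<Rightarrow> nat" where
  "corner_index m d = (\<lambda>i\<in>{1..d}. m - 1)"

definition corner_index_left :: "nat \<Rightarrow> nat \<Rightarrow> nat \<Rightarrow> nat" where
  "corner_index_left m d = (\<lambda>i\<in>{1..d}. if i = 1 then m - 2 else m - 1)"

lemma corner_indices:
  assumes "m \<ge> 2" "d \<ge> 2"
  shows "corner_index m d \<in> grid_indices m d" "corner_index_left m d \<in> grid_indices m d"
    "corner_index m d \<noteq> corner_index_left m d"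
proof -
  show "corner_index m d \<in> grid_indices m d" "corner_index_left m d \<in> grid_indices m d"
    using assms by (auto simp: corner_index_def corner_index_left_def grid_indices_def PiE_iff)
  have "corner_index m d 1 \<noteq> corner_index_left m d 1"
    using assms by (simp add: corner_index_def corner_index_left_def)
  then show "corner_index m d \<noteq> corner_index_left m d"
    by metis
qed

text \<open>
  Inclusion of boxes is coordinatewise. A side \<open>[n / m, (n + 1) / m]\<close> with \<open>n < m\<close> lies in the
  interval \<open>[(m - w) / m, 1]\<close> exactly if \<open>m - w \<le> n\<close>, where \<open>w\<close> is \<open>2\<close> in the first direction and
  \<open>1\<close> in the others.
\<close>

lemma grid_cube_subset_merged_box_iff:
  assumes m: "m \<ge> 2" and k: "k \<in> grid_indices m d"
  shows "grid_cube m d k \<subseteq> merged_box m d \<longleftrightarrow> k \<in> {corner_index m d, corner_index_left m d}"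
proof -
  have ne: "{real n / real m..(real n + 1) / real m} \<noteq> {}" for n
    using m by (auto simp: divide_right_mono)
  have k_lt: "k i < m" if "i \<in> {1..d}" for i
    using k that by (auto simp: grid_indices_def PiE_iff)
  have ext: "k \<in> extensional {1..d}"
    using k by (auto simp: grid_indices_def PiE_iff)
  have side: "{real n / real m..(real n + 1) / real m}
      \<subseteq> {corner m i .. corner m i + (if i = 1 then 2 else 1) * (1 / real m)}
      \<longleftrightarrow> n = m - 1 \<or> (i = 1 \<and> n = m - 2)" if "n < m" for n i
  proof -
    define w :: nat where "w = (if i = 1 then 2 else 1)"
    have lower: "corner m i = real (m - w) / real m"
      using m by (auto simp: corner_def w_def of_nat_diff)
    have upper: "corner m i + (if i = 1 then 2 else 1) * (1 / real m) = 1"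
      using m by (auto simp: corner_def field_simps)
    have "{real n / real m..(real n + 1) / real m} \<subseteq> {corner m i..1}
        \<longleftrightarrow> real (m - w) / real m \<le> real n / real m \<and> (real n + 1) / real m \<le> 1"
      using ne[of n] unfolding lower by auto
    also have "\<dots> \<longleftrightarrow> m - w \<le> n"
      using m that by (auto simp: divide_le_cancel)
    also have "\<dots> \<longleftrightarrow> n = m - 1 \<or> (i = 1 \<and> n = m - 2)"
      using m that by (auto simp: w_def)
    finally show ?thesis
      unfolding upper .
  qed
  have "grid_cube m d k \<subseteq> merged_box m d \<longleftrightarrow> (\<forall>i\<in>{1..d}. k i = m - 1 \<or> (i = 1 \<and> k i = m - 2))"
    unfolding grid_cube_def merged_box_def subset_PiE PiE_eq_empty_iff
    using ne side k_lt by blast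
  also have "\<dots> \<longleftrightarrow> k \<in> {corner_index m d, corner_index_left m d}"
  proof
    assume *: "\<forall>i\<in>{1..d}. k i = m - 1 \<or> (i = 1 \<and> k i = m - 2)"
    have "k = corner_index_left m d" if "k 1 = m - 2"
      using * that ext by (intro extensionalityI[of _ "{1..d}"]) (auto simp: corner_index_left_def)
    moreover have "k = corner_index m d" if "k 1 \<noteq> m - 2"
      using * that ext by (intro extensionalityI[of _ "{1..d}"]) (auto simp: corner_index_def)
    ultimately show "k \<in> {corner_index m d, corner_index_left m d}"
      by blast
  qed (auto simp: corner_index_def corner_index_left_def split: if_splits)
  finally show ?thesis .
qed

lemma remaining_cubes_eq:
  assumes "m \<ge> 2"
  shows "remaining_cubes m d
       = grid_cube m d ` (grid_indices m d - {corner_index m d, corner_index_left m d})"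
  unfolding remaining_cubes_def grid_cubes_eq using grid_cube_subset_merged_box_iff[OF assms] by blast

lemma merged_box_fmeasurable: "merged_box m d \<in> fmeasurable (lborel_pow d)"
  unfolding merged_box_def by (rule PiE_fmeasurable) auto

lemma measure_merged_box:
  assumes "m \<ge> 2" "d \<ge> 2"
  shows "measure (lborel_pow d) (merged_box m d) = 2 / real (m ^ d)"
proof -
  have "measure (lborel_pow d) (merged_box m d) = (\<Prod>i\<in>{1..d}. (if i = 1 then 2 else 1) * (1 / real m))"
    unfolding merged_box_def by (subst measure_lborel_pow_PiE) (auto intro!: prod.cong)
  also have "\<dots> = 2 / real (m ^ d)"
    using assms by (simp add: prod.distrib power_one_over prod.delta prod_dividef)
  finally show ?thesis .
qed

lemma measure_merged_box_Int_anchored_box: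
  assumes "m \<ge> 2" "d \<ge> 2"
  shows "measure (lborel_pow d) (merged_box m d \<inter> anchored_box d z)
       = measure (lborel_pow d) (grid_cube m d (corner_index m d) \<inter> anchored_box d z)
       + measure (lborel_pow d) (grid_cube m d (corner_index_left m d) \<inter> anchored_box d z)"
proof -
  have split: "(\<Prod>i\<in>{1..d}. f i) = f 1 * (\<Prod>i\<in>{2..d}. f i)" for f :: "nat \<Rightarrow> real"
    using assms by (simp add: prod.atLeast_Suc_atMost numeral_2_eq_2)
  define R where "R = (\<Prod>i\<in>{2..d}. overlap ((real m - 1) / real m) 1 (z i))"
  have one: "(real m - 1) / real m + 1 / real m = 1"
    using assms by (simp add: field_simps)
  have two: "(real m - 2) / real m + 2 / real m = 1"
    using assms by (simp add: field_simps)
  have "measure (lborel_pow d) (merged_box m d \<inter> anchored_box d z)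
      = overlap ((real m - 2) / real m) 1 (z 1) * R"
  proof -
    have "measure (lborel_pow d) (merged_box m d \<inter> anchored_box d z)
        = (\<Prod>i\<in>{1..d}. overlap (corner m i) (corner m i + (if i = 1 then 2 else 1) * (1 / real m)) (z i))"
      unfolding merged_box_def using assms
      by (intro measure_Icc_box_Int_anchored_box) (auto simp: corner_def)
    then show ?thesis
      unfolding split R_def by (simp add: corner_def one two)
  qed
  also have "overlap ((real m - 2) / real m) 1 (z 1)
      = overlap ((real m - 2) / real m) ((real m - 1) / real m) (z 1) + overlap ((real m - 1) / real m) 1 (z 1)"
    using assms by (intro overlap_append[symmetric]) (auto simp: divide_right_mono)
  finally have "measure (lborel_pow d) (merged_box m d \<inter> anchored_box d z)
      = overlap ((real m - 1) / real m) 1 (z 1) * R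
      + overlap ((real m - 2) / real m) ((real m - 1) / real m) (z 1) * R"
    by (simp add: algebra_simps)
  moreover have "measure (lborel_pow d) (grid_cube m d (corner_index m d) \<inter> anchored_box d z)
      = overlap ((real m - 1) / real m) 1 (z 1) * R"
    using assms unfolding measure_grid_cube_Int_anchored_box split R_def
    by (simp add: corner_index_def of_nat_diff)
  moreover have "measure (lborel_pow d) (grid_cube m d (corner_index_left m d) \<inter> anchored_box d z)
      = overlap ((real m - 2) / real m) ((real m - 1) / real m) (z 1) * R"
    using assms unfolding measure_grid_cube_Int_anchored_box split R_def
    by (simp add: corner_index_left_def of_nat_diff)
  ultimately show ?thesis
    by simp
qed

section \<open>The two convex parts of the merged box\<close>

text \<open>
  The affine function whose zero set is the cutting hyperplane; the centre of the merged box is on it.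
\<close>

definition tilt :: "nat \<Rightarrow> real \<Rightarrow> (nat \<Rightarrow> real) \<Rightarrow> real" where
  "tilt m \<theta> x = (x 1 - corner m 1 - 1 / real m) * sin \<theta>
     + (x 2 - corner m 2 - (1 / real m) / 2) * cos \<theta>"

lemma lower_part_eq: "lower_part m d \<theta> = {x \<in> merged_box m d. tilt m \<theta> x \<le> 0}"
  by (simp add: lower_part_def tilt_def)

text \<open>
  The upper part is defined as a closure, which has to be identified before it can be measured.
  One inclusion holds since the right-hand side is closed. For the other, a point of the cut is
  approached from the open side along the segment to the far vertex \<open>v\<close> of the merged box: this segment
  stays in the box by convexity, and the affine function \<open>tilt\<close> is positive at \<open>v\<close>.
\<close>

lemma upper_part_eq:
  assumes "m > 0" "d \<ge> 2" "0 \<le> \<theta>" "\<theta> \<le> pi / 2"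
  shows "upper_part m d \<theta> = {x \<in> merged_box m d. 0 \<le> tilt m \<theta> x}"
proof
  let ?X = "powertop_real {1..d}"
  have cont: "continuous_map ?X euclideanreal (tilt m \<theta>)"
    unfolding tilt_def[abs_def] using assms by (intro continuous_intros) auto
  have box: "closedin ?X (merged_box m d)"
    unfolding merged_box_def by (simp add: closedin_product_topology)
  have "closedin ?X {x \<in> merged_box m d. tilt m \<theta> x \<in> {0..}}"
    using closedin_continuous_map_preimage_gen[OF cont box, of "{0..}"] by simp
  then show "upper_part m d \<theta> \<subseteq> {x \<in> merged_box m d. 0 \<le> tilt m \<theta> x}"
    unfolding upper_part_def lower_part_eq by (intro closure_of_minimal) auto
  show "{x \<in> merged_box m d. 0 \<le> tilt m \<theta> x} \<subseteq> upper_part m d \<theta>"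
  proof clarify
    fix x assume x: "x \<in> merged_box m d" and tx: "0 \<le> tilt m \<theta> x"
    define v where "v = (\<lambda>i. corner m i + (if i = 1 then 2 else 1) * (1 / real m))"
    define \<gamma> where "\<gamma> t = (\<lambda>i\<in>{1..d}. x i + t * (v i - x i))" for t
    have cont_\<gamma>: "continuous_map euclideanreal ?X \<gamma>"
      unfolding \<gamma>_def[abs_def] continuous_map_componentwise
      by (auto intro!: continuous_intros)
    have "0 < sin \<theta> + cos \<theta> / 2"
    proof (cases "\<theta> = 0")
      case False
      then have "0 < sin \<theta>" "0 \<le> cos \<theta>"
        using assms by (auto intro!: sin_gt_zero cos_ge_zero)
      then show ?thesis by simp
    qed simp
    moreover have "tilt m \<theta> v = (sin \<theta> + cos \<theta> / 2) / real m"
      using assms by (simp add: tilt_def v_def field_simps)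
    ultimately have tv: "0 < tilt m \<theta> v"
      using assms by simp
    have \<gamma>_in: "\<gamma> t \<in> merged_box m d - lower_part m d \<theta>" if t: "0 < t" "t \<le> 1" for t
    proof -
      have xi: "corner m i \<le> x i" "x i \<le> v i" if "i \<in> {1..d}" for i
        using x that unfolding merged_box_def v_def by (auto simp: PiE_iff)
      have "corner m i \<le> \<gamma> t i \<and> \<gamma> t i \<le> v i" if i: "i \<in> {1..d}" for i
      proof -
        have "0 \<le> t * (v i - x i)" "t * (v i - x i) \<le> 1 * (v i - x i)"
          using t xi[OF i] by (intro mult_nonneg_nonneg mult_right_mono; simp)+
        then show ?thesis
          using xi[OF i] i by (simp add: \<gamma>_def)
      qed
      then have "\<gamma> t \<in> merged_box m d"
        unfolding merged_box_def v_def by (auto simp: PiE_iff \<gamma>_def)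
      moreover have "tilt m \<theta> (\<gamma> t) = (1 - t) * tilt m \<theta> x + t * tilt m \<theta> v"
      proof -
        define a b where "a = corner m 1 + 1 / real m" and "b = corner m 2 + (1 / real m) / 2"
        have tilt: "tilt m \<theta> y = (y 1 - a) * sin \<theta> + (y 2 - b) * cos \<theta>" for y
          by (simp add: tilt_def a_def b_def algebra_simps)
        show ?thesis
          unfolding tilt using assms by (simp add: \<gamma>_def algebra_simps)
      qed
      then have "0 < tilt m \<theta> (\<gamma> t)"
        using t tx tv by (simp add: add_nonneg_pos)
      ultimately show ?thesis
        by (simp add: lower_part_eq)
    qed
    \<comment> \<open>a continuous map sends closure points to closure points; it is applied at the endpoint 0 of the open parameter range\<close>
    have "\<gamma> ` (euclideanreal closure_of {0<..1}) \<subseteq> ?X closure_of (\<gamma> ` {0<..1})"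
      by (rule continuous_map_image_closure_subset[OF cont_\<gamma>])
    moreover have "\<gamma> 0 = x"
      using x by (auto simp: \<gamma>_def merged_box_def PiE_iff extensional_def)
    moreover have "(0::real) \<in> euclideanreal closure_of {0<..1}"
      by (simp add: euclidean_closure_of closure_greaterThanAtMost)
    ultimately have "x \<in> ?X closure_of (\<gamma> ` {0<..1})"
      by (metis imageI subsetD)
    also have "\<dots> \<subseteq> upper_part m d \<theta>"
      unfolding upper_part_def using \<gamma>_in by (intro closure_of_mono) auto
    finally show "x \<in> upper_part m d \<theta>" .
  qed
qed

lemma tilt_measurable [measurable]:
  assumes "d \<ge> 2"
  shows "tilt m \<theta> \<in> borel_measurable (lborel_pow d)"
proof -
  have coord: "(\<lambda>x. x i) \<in> borel_measurable (lborel_pow d)" if "i \<in> {1..d}" for i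
    using measurable_component_singleton[OF that, of "\<lambda>_. lborel :: real measure"] by simp
  have [measurable]: "(\<lambda>x. x 1) \<in> borel_measurable (lborel_pow d)"
    "(\<lambda>x. x 2) \<in> borel_measurable (lborel_pow d)"
    using assms by (intro coord; simp)+
  show ?thesis
    unfolding tilt_def[abs_def] by measurable
qed

lemma parts_fmeasurable:
  assumes "m > 0" "d \<ge> 2" "0 \<le> \<theta>" "\<theta> \<le> pi / 2"
  shows "lower_part m d \<theta> \<in> fmeasurable (lborel_pow d)" "upper_part m d \<theta> \<in> fmeasurable (lborel_pow d)"
proof -
  have box: "merged_box m d \<in> sets (lborel_pow d)"
    using merged_box_fmeasurable by auto
  note [measurable] = tilt_measurable[OF assms(2)] box
  have "merged_box m d \<inter> {x \<in> space (lborel_pow d). tilt m \<theta> x \<le> 0} \<in> sets (lborel_pow d)"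
    "merged_box m d \<inter> {x \<in> space (lborel_pow d). 0 \<le> tilt m \<theta> x} \<in> sets (lborel_pow d)"
    by measurable
  moreover have "lower_part m d \<theta> = merged_box m d \<inter> {x \<in> space (lborel_pow d). tilt m \<theta> x \<le> 0}"
    "upper_part m d \<theta> = merged_box m d \<inter> {x \<in> space (lborel_pow d). 0 \<le> tilt m \<theta> x}"
    using sets.sets_into_space[OF box] by (auto simp: lower_part_eq upper_part_eq[OF assms])
  ultimately have "lower_part m d \<theta> \<in> sets (lborel_pow d)" "upper_part m d \<theta> \<in> sets (lborel_pow d)"
    by auto
  moreover have "lower_part m d \<theta> \<subseteq> merged_box m d" "upper_part m d \<theta> \<subseteq> merged_box m d"
    by (auto simp: lower_part_eq upper_part_eq[OF assms])
  ultimately show "lower_part m d \<theta> \<in> fmeasurable (lborel_pow d)" "upper_part m d \<theta> \<in> fmeasurable (lborel_pow d)"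
    using fmeasurableI2[OF merged_box_fmeasurable] by blast+
qed

text \<open>
  The normal vector \<open>(sin \<theta>, cos \<theta>)\<close> is nonzero, so one of the first two coordinate directions is
  transversal to the cutting hyperplane.
\<close>

lemma AE_tilt_nonzero:
  assumes "d \<ge> 2"
  shows "AE x in lborel_pow d. tilt m \<theta> x \<noteq> 0"
proof -
  interpret product_sigma_finite "\<lambda>_::nat. lborel :: real measure"
    by (rule product_sigma_finite_lborel)
  define H where "H = {x \<in> space (lborel_pow d). tilt m \<theta> x = 0}"
  have H: "H \<in> sets (lborel_pow d)"
    unfolding H_def using tilt_measurable[OF assms] by measurable
  have "sin \<theta> \<noteq> 0 \<or> cos \<theta> \<noteq> 0"
    by (metis sin_zero_abs_cos_one abs_zero zero_neq_one)
  then have "H \<in> null_sets (lborel_pow d)"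
  proof
    assume s: "sin \<theta> \<noteq> 0"
    show ?thesis
    proof (rule null_sets_PiM_if_lines_null[OF _ _ H, of 1])
      fix x
      have "{y. x(1 := y) \<in> H} \<subseteq>
          {corner m 1 + 1 / real m - (x 2 - corner m 2 - (1 / real m) / 2) * cos \<theta> / sin \<theta>}"
        using s by (auto simp: H_def tilt_def field_simps)
      then have "finite {y. x(1 := y) \<in> H}"
        by (rule finite_subset) simp
      then show "{y. x(1 := y) \<in> H} \<in> null_sets lborel"
        by (rule finite_imp_null_set_lborel)
    qed (use assms in auto)
  next
    assume c: "cos \<theta> \<noteq> 0"
    show ?thesis
    proof (rule null_sets_PiM_if_lines_null[OF _ _ H, of 2])
      fix x
      have "{y. x(2 := y) \<in> H} \<subseteq>
          {corner m 2 + (1 / real m) / 2 - (x 1 - corner m 1 - 1 / real m) * sin \<theta> / cos \<theta>}"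
        using c by (auto simp: H_def tilt_def field_simps)
      then have "finite {y. x(2 := y) \<in> H}"
        by (rule finite_subset) simp
      then show "{y. x(2 := y) \<in> H} \<in> null_sets lborel"
        by (rule finite_imp_null_set_lborel)
    qed (use assms in auto)
  qed
  then show ?thesis
    by (rule AE_I') (auto simp: H_def)
qed

lemma measure_parts_Int:
  assumes "m > 0" "d \<ge> 2" "0 \<le> \<theta>" "\<theta> \<le> pi / 2" and S: "S \<in> sets (lborel_pow d)"
  shows "measure (lborel_pow d) (lower_part m d \<theta> \<inter> S) + measure (lborel_pow d) (upper_part m d \<theta> \<inter> S)
       = measure (lborel_pow d) (merged_box m d \<inter> S)"
proof -
  note parts = parts_fmeasurable[OF assms(1-4)]
  have union: "merged_box m d \<inter> S = (lower_part m d \<theta> \<inter> S) \<union> (upper_part m d \<theta> \<inter> S)"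
    by (auto simp: lower_part_eq upper_part_eq[OF assms(1-4)])
  have "AE x in lborel_pow d. x \<notin> lower_part m d \<theta> \<inter> S \<or> x \<notin> upper_part m d \<theta> \<inter> S"
    using AE_tilt_nonzero[OF assms(2), of m \<theta>]
    by eventually_elim (auto simp: lower_part_eq upper_part_eq[OF assms(1-4)])
  then show ?thesis
    unfolding union using parts S by (intro measure_Un_AE[symmetric]) (auto intro: fmeasurable_Int_fmeasurable)
qed

text \<open>
  The reflection in the centre of the merged box preserves the box and changes the sign of \<open>tilt\<close>,
  hence it exchanges the two parts.
\<close>

lemma measure_upper_part_eq_lower_part:
  assumes "m > 0" "d \<ge> 2" "0 \<le> \<theta>" "\<theta> \<le> pi / 2"
  shows "measure (lborel_pow d) (upper_part m d \<theta>) = measure (lborel_pow d) (lower_part m d \<theta>)"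
proof -
  \<comment> \<open>twice the centre of the merged box\<close>
  define c where "c i = 2 * corner m i + (if i = 1 then 2 else 1) * (1 / real m)" for i
  define T :: "(nat \<Rightarrow> real) \<Rightarrow> nat \<Rightarrow> real" where "T x = (\<lambda>i\<in>{1..d}. c i - x i)" for x
  have T: "T \<in> measurable (lborel_pow d) (lborel_pow d)"
    unfolding T_def[abs_def] by measurable
  have distr: "distr (lborel_pow d) (lborel_pow d) T = lborel_pow d"
    unfolding T_def[abs_def] by (rule distr_reflect_PiM_lborel) simp
  have L: "lower_part m d \<theta> \<in> sets (lborel_pow d)"
    using parts_fmeasurable(1)[OF assms] by auto
  have tilt: "tilt m \<theta> (T x) = - tilt m \<theta> x" for x
    using assms by (simp add: tilt_def c_def T_def algebra_simps)
  have box: "T x \<in> merged_box m d \<longleftrightarrow> x \<in> merged_box m d" if "x \<in> extensional {1..d}" for x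
    using that by (auto simp: merged_box_def PiE_iff c_def T_def)
  have ext: "x \<in> merged_box m d \<Longrightarrow> x \<in> extensional {1..d}" for x
    by (simp add: merged_box_def PiE_iff)
  have "T -` lower_part m d \<theta> \<inter> space (lborel_pow d) = upper_part m d \<theta>"
    unfolding lower_part_eq upper_part_eq[OF assms]
    using box ext by (auto simp: tilt space_PiM PiE_def)
  then show ?thesis
    using measure_distr[OF T L] unfolding distr by simp
qed

lemma measure_parts:
  assumes "m \<ge> 2" "d \<ge> 2" "0 \<le> \<theta>" "\<theta> \<le> pi / 2"
  shows "measure (lborel_pow d) (lower_part m d \<theta>) = 1 / real (m ^ d)"
    "measure (lborel_pow d) (upper_part m d \<theta>) = 1 / real (m ^ d)"
proof -
  have sub: "lower_part m d \<theta> \<subseteq> merged_box m d" "upper_part m d \<theta> \<subseteq> merged_box m d"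
    using assms by (auto simp: lower_part_eq upper_part_eq)
  then have "measure (lborel_pow d) (lower_part m d \<theta>) + measure (lborel_pow d) (upper_part m d \<theta>)
      = 2 / real (m ^ d)"
    using measure_parts_Int[of m d \<theta> "merged_box m d"] measure_merged_box[of m d]
      merged_box_fmeasurable[of m d] assms by (simp add: Int_absorb2 fmeasurableD)
  then show "measure (lborel_pow d) (lower_part m d \<theta>) = 1 / real (m ^ d)"
    "measure (lborel_pow d) (upper_part m d \<theta>) = 1 / real (m ^ d)"
    using measure_upper_part_eq_lower_part[of m d \<theta>] assms by auto
qed

section \<open>Local discrepancy of stratified points\<close>

text \<open>
  In each direction \<open>i\<close> the hyperplane \<open>x i = z i\<close>, which carries a face of the anchored box, meets the
  interiors of the cubes of at most one layer of the grid, the one with index \<open>\<lfloor>m z i\<rfloor>\<close>; a layer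
  has \<open>m ^ (d - 1)\<close> cubes.
\<close>

lemma card_cut_grid_indices:
  assumes "m > 0"
  shows "card {k \<in> grid_indices m d. \<exists>i\<in>{1..d}. real (k i) / real m < z i \<and> z i < (real (k i) + 1) / real m}
       \<le> d * m ^ (d - 1)"
proof -
  define S where "S i = (\<Pi>\<^sub>E j\<in>{1..d}. if j = i then {nat \<lfloor>real m * z i\<rfloor>} else {..<m})" for i
  have card_S: "card (S i) = m ^ (d - 1)" if i: "i \<in> {1..d}" for i
  proof -
    have "card (S i) = (\<Prod>j\<in>{1..d}. if j = i then 1 else m)"
      by (auto simp: S_def card_PiE intro!: prod.cong)
    also have "\<dots> = (\<Prod>j\<in>{1..d} - {i}. m)"
      using i by (subst prod.remove[of _ i]) (auto intro!: prod.cong)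
    also have "\<dots> = m ^ (d - 1)"
      using i by (simp add: card_Diff_subset)
    finally show ?thesis .
  qed
  have fin: "finite (S i)" for i
    unfolding S_def by (intro finite_PiE) auto
  have "{k \<in> grid_indices m d. \<exists>i\<in>{1..d}. real (k i) / real m < z i \<and> z i < (real (k i) + 1) / real m}
      \<subseteq> (\<Union>i\<in>{1..d}. S i)"
  proof clarify
    fix k i assume k: "k \<in> grid_indices m d" and i: "i \<in> {1..d}"
      and lt: "real (k i) / real m < z i" "z i < (real (k i) + 1) / real m"
    have "\<lfloor>real m * z i\<rfloor> = int (k i)"
      using lt assms by (intro floor_unique) (auto simp: field_simps)
    then have "k i = nat \<lfloor>real m * z i\<rfloor>"
      by simp
    then have "k \<in> S i"
      using k by (auto simp: S_def grid_indices_def PiE_iff)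
    then show "k \<in> (\<Union>i\<in>{1..d}. S i)"
      using i by blast
  qed
  then have "card {k \<in> grid_indices m d. \<exists>i\<in>{1..d}. real (k i) / real m < z i \<and> z i < (real (k i) + 1) / real m}
      \<le> card (\<Union>i\<in>{1..d}. S i)"
    using fin by (intro card_mono) auto
  also have "\<dots> \<le> (\<Sum>i\<in>{1..d}. card (S i))"
    by (rule card_UN_le) simp
  also have "\<dots> = d * m ^ (d - 1)"
    by (simp add: card_S)
  finally show ?thesis .
qed

text \<open>
  A cube whose interior meets none of these hyperplanes is inside or outside the anchored box, up to a null set. In the product
  formula every factor is then \<open>0\<close> or \<open>1\<close>. So the corresponding stratum contributes no variance.
\<close>

lemma relative_volume_uncut_grid_cube:
  assumes "m > 0"
    and uncut: "\<not> (\<exists>i\<in>{1..d}. real (k i) / real m < z i \<and> z i < (real (k i) + 1) / real m)"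
  shows "real (m ^ d) * measure (lborel_pow d) (grid_cube m d k \<inter> anchored_box d z) \<in> {0, 1}"
proof -
  have "real (m ^ d) * measure (lborel_pow d) (grid_cube m d k \<inter> anchored_box d z)
      = (\<Prod>i\<in>{1..d}. real m * overlap (real (k i) / real m) ((real (k i) + 1) / real m) (z i))"
      (is "?v = (\<Prod>i\<in>_. ?f i)")
    unfolding measure_grid_cube_Int_anchored_box prod.distrib by simp
  moreover have factor: "?f i \<in> {0, 1}"
    if "i \<in> {1..d}" for i
  proof (cases "z i \<le> real (k i) / real m")
    case False
    moreover have "\<not> (real (k i) / real m < z i \<and> z i < (real (k i) + 1) / real m)"
      using uncut that by blast
    ultimately have "(real (k i) + 1) / real m \<le> z i"
      by linarith
    then show ?thesis
      using assms by (simp add: overlap_def diff_divide_distrib[symmetric])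
  qed (simp add: overlap_def)
  have zero_one: "(\<Prod>i\<in>A. f i) \<in> {0, 1}" if "\<And>i. i \<in> A \<Longrightarrow> f i \<in> {0, 1}"
    for A and f :: "nat \<Rightarrow> real"
  proof (cases "finite A \<and> (\<exists>i\<in>A. f i = 0)")
    case False
    then have "(\<Prod>i\<in>A. f i) = 1"
      using that by (cases "finite A") (auto intro: prod.neutral)
    then show ?thesis by simp
  qed (auto intro: prod_zero)
  have "(\<Prod>i\<in>{1..d}. ?f i) \<in> {0, 1}"
    by (rule zero_one[OF factor])
  ultimately show ?thesis
    by (simp only:)
qed

lemma mult_one_minus_le_quarter: "p * (1 - p) \<le> 1 / 4" for p :: real
  using zero_le_power2[of "p - 1 / 2"] by (simp add: power2_eq_square algebra_simps)

context
  fixes m d N :: nat and \<theta> :: real and \<Omega> :: "nat \<Rightarrow> (nat \<Rightarrow> real) set"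
  assumes m: "m \<ge> 2" and d: "d \<ge> 2" and \<theta>: "0 \<le> \<theta>" "\<theta> \<le> pi / 2"
    and N: "N = m ^ d" and part: "local_convex_partition m d \<theta> \<Omega>"
begin

lemma N_ge_4: "N \<ge> 4"
proof -
  have "(2::nat) ^ 2 \<le> m ^ d"
    using m d by (meson le_trans power_increasing power_mono one_le_numeral le0)
  then show ?thesis
    by (simp add: N)
qed

text \<open>
  The order of the strata that are grid cubes is arbitrary; in a sum over all strata it can be replaced by
  the enumeration of the grid cubes by multi-indices.
\<close>

lemma sum_over_partition:
  fixes f :: "(nat \<Rightarrow> real) set \<Rightarrow> real"
  shows "(\<Sum>i\<in>{1..N}. f (\<Omega> i)) = f (lower_part m d \<theta>) + f (upper_part m d \<theta>)
     + (\<Sum>k\<in>grid_indices m d - {corner_index m d, corner_index_left m d}. f (grid_cube m d k))"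
proof -
  have "{1..N} = insert 1 (insert 2 {3..N})"
    using N_ge_4 by auto
  then have "(\<Sum>i\<in>{1..N}. f (\<Omega> i)) = f (\<Omega> 1) + (f (\<Omega> 2) + (\<Sum>i\<in>{3..N}. f (\<Omega> i)))"
    by simp
  also have "(\<Sum>i\<in>{3..N}. f (\<Omega> i)) = (\<Sum>Q\<in>remaining_cubes m d. f Q)"
    using part unfolding local_convex_partition_def N by (intro sum.reindex_bij_betw) auto
  also have "\<dots> = (\<Sum>k\<in>grid_indices m d - {corner_index m d, corner_index_left m d}. f (grid_cube m d k))"
    unfolding remaining_cubes_eq[OF m] using m inj_on_grid_cube[of m d]
    by (subst sum.reindex) (auto intro: inj_on_subset)
  finally show ?thesis
    using part by (simp add: local_convex_partition_def)
qed

lemma partition_volume: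
  assumes i: "i \<in> {1..N}"
  shows "\<Omega> i \<in> fmeasurable (lborel_pow d)" "measure (lborel_pow d) (\<Omega> i) = 1 / real N"
proof -
  have "\<Omega> i \<in> fmeasurable (lborel_pow d) \<and> measure (lborel_pow d) (\<Omega> i) = 1 / real N"
  proof -
    consider "i = 1" | "i = 2" | "i \<in> {3..N}"
      using i by force
    then show ?thesis
    proof cases
      case 3
      then have "\<Omega> i \<in> remaining_cubes m d"
        using part unfolding local_convex_partition_def N by (auto dest: bij_betwE)
      then obtain k where "\<Omega> i = grid_cube m d k"
        unfolding remaining_cubes_eq[OF m] by blast
      then show ?thesis
        using m measure_grid_cube[of m d k] grid_cube_fmeasurable[of m d k] by (simp add: N)
    qed (use part parts_fmeasurable[of m d \<theta>] measure_parts[of m d \<theta>] m d \<theta>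
          in \<open>simp_all add: local_convex_partition_def N\<close>)
  qed
  then show "\<Omega> i \<in> fmeasurable (lborel_pow d)" "measure (lborel_pow d) (\<Omega> i) = 1 / real N"
    by auto
qed

text \<open>
  The strata partition the cube up to null sets, seen through volumes: the two convex parts have the
  volume of the merged box, which has the volume of the two cubes it replaces. This is what makes the
  stratified sample unbiased.
\<close>

lemma sum_measure_partition_Int_anchored_box:
  assumes z: "z \<in> unit_cube d"
  shows "(\<Sum>i\<in>{1..N}. measure (lborel_pow d) (\<Omega> i \<inter> anchored_box d z))
       = measure (lborel_pow d) (anchored_box d z)"
proof -
  let ?v = "\<lambda>S. measure (lborel_pow d) (S \<inter> anchored_box d z)"
  let ?K = "{corner_index m d, corner_index_left m d}"
  have "(\<Sum>i\<in>{1..N}. ?v (\<Omega> i)) = ?v (merged_box m d) + (\<Sum>k\<in>grid_indices m d - ?K. ?v (grid_cube m d k))"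
    using sum_over_partition[of ?v] m
      measure_parts_Int[OF _ d \<theta> fmeasurableD[OF anchored_box_fmeasurable], of m z]
    by simp
  also have "?v (merged_box m d) = (\<Sum>k\<in>?K. ?v (grid_cube m d k))"
    unfolding measure_merged_box_Int_anchored_box[OF m d] using corner_indices[OF m d] by simp
  also have "\<dots> + (\<Sum>k\<in>grid_indices m d - ?K. ?v (grid_cube m d k))
      = (\<Sum>k\<in>grid_indices m d. ?v (grid_cube m d k))"
    using corner_indices[OF m d] by (subst sum.subset_diff[of ?K "grid_indices m d"]) auto
  finally show ?thesis
    using sum_measure_grid_cube_Int_anchored_box[OF _ z, of m] m by simp
qed

text \<open>
  Only the strata met by the boundary of the anchored box have positive variance, and each
  variance is at most \<open>1 / 4\<close>. The summand \<open>2\<close> accounts for the two convex parts, which are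
  both counted as if they were cut.
\<close>

lemma sum_bernoulli_variances_le:
  "(\<Sum>i\<in>{1..N}. let p = real N * measure (lborel_pow d) (\<Omega> i \<inter> anchored_box d z) in p * (1 - p))
     \<le> (real d * real m ^ (d - 1) + 2) / 4"
proof -
  define q where "q S = (let p = real N * measure (lborel_pow d) (S \<inter> anchored_box d z) in p * (1 - p))"
    for S
  let ?K = "{corner_index m d, corner_index_left m d}"
  define cut where "cut = {k \<in> grid_indices m d. \<exists>i\<in>{1..d}. real (k i) / real m < z i \<and> z i < (real (k i) + 1) / real m}"
  have q_le: "q S \<le> 1 / 4" for S
    unfolding q_def Let_def by (rule mult_one_minus_le_quarter)
  have q_uncut: "q (grid_cube m d k) = 0" if "k \<in> grid_indices m d - cut" for k
    using relative_volume_uncut_grid_cube[of m d k z] that m unfolding N q_def cut_def Let_def by auto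
  have "(\<Sum>k\<in>grid_indices m d - ?K. q (grid_cube m d k)) \<le> (\<Sum>k\<in>grid_indices m d - ?K. if k \<in> cut then 1 / 4 else 0)"
    using q_le q_uncut by (intro sum_mono) auto
  also have "\<dots> \<le> (\<Sum>k\<in>grid_indices m d. if k \<in> cut then 1 / 4 else 0)"
    by (intro sum_mono2) auto
  also have "\<dots> = real (card cut) / 4"
  proof -
    have "grid_indices m d \<inter> cut = cut"
      by (auto simp: cut_def)
    then show ?thesis
      by (simp add: sum.If_cases)
  qed
  also have "\<dots> \<le> real d * real m ^ (d - 1) / 4"
  proof -
    have "real (card cut) \<le> real (d * m ^ (d - 1))"
      using card_cut_grid_indices[of m d z] m unfolding cut_def of_nat_le_iff by simp
    then show ?thesis
      by simp
  qed
  finally have "(\<Sum>i\<in>{1..N}. q (\<Omega> i)) \<le> (real d * real m ^ (d - 1) + 2) / 4"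
    using sum_over_partition[of q] q_le[of "lower_part m d \<theta>"] q_le[of "upper_part m d \<theta>"] by simp
  then show ?thesis
    by (simp add: q_def)
qed

text \<open>
  By unbiasedness the mean square of the local discrepancy at \<open>z\<close> is a variance, namely the sum of the
  Bernoulli variances of the strata divided by \<open>N\<^sup>2\<close>.
\<close>

lemma expectation_local_discrepancy_le:
  assumes X: "stratified_points M d N \<Omega> X" and z: "z \<in> unit_cube d"
  shows "prob_space.expectation M (\<lambda>\<omega>. (measure (lborel_pow d) (anchored_box d z)
            - 1 / real N * (\<Sum>i=1..N. indicator (anchored_box d z) (X i \<omega>)))\<^sup>2)
       \<le> (real d * real m ^ (d - 1) + 2) / (4 * (real N)\<^sup>2)"
proof -
  interpret prob_space M
    using X by (simp add: stratified_points_def)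
  let ?L = "lborel_pow d" and ?B = "anchored_box d z"
  define p where "p i = measure (distr M ?L (X i)) ?B" for i
  have indep: "indep_vars (\<lambda>_. ?L) X {1..N}"
    using X by (simp add: stratified_points_def)
  have N_pos: "real N > 0"
    using N_ge_4 by simp
  have B: "?B \<in> sets ?L"
    by (rule fmeasurableD[OF anchored_box_fmeasurable])
  have p: "p i = real N * measure ?L (\<Omega> i \<inter> ?B)" if i: "i \<in> {1..N}" for i
  proof -
    have "emeasure ?L (\<Omega> i) = ennreal (1 / real N)"
      using partition_volume[OF i] by (simp add: emeasure_eq_measure2)
    then have "measure (uniform_measure ?L (\<Omega> i)) ?B = measure ?L (\<Omega> i \<inter> ?B) / measure ?L (\<Omega> i)"
      using N_pos B by (intro measure_uniform_measure) auto
    moreover have "distr M ?L (X i) = uniform_measure ?L (\<Omega> i)"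
      using X i unfolding stratified_points_def by blast
    ultimately show ?thesis
      using partition_volume(2)[OF i] by (simp add: p_def)
  qed
  have "(\<Sum>i\<in>{1..N}. p i) = real N * (\<Sum>i\<in>{1..N}. measure ?L (\<Omega> i \<inter> ?B))"
    unfolding sum_distrib_left by (intro sum.cong refl p)
  then have sum_p: "(\<Sum>i\<in>{1..N}. p i) = real N * measure ?L ?B"
    unfolding sum_measure_partition_Int_anchored_box[OF z] .
  have "measure ?L ?B - 1 / real N * (\<Sum>i=1..N. indicator ?B (X i \<omega>))
      = ((\<Sum>i\<in>{1..N}. p i) - (\<Sum>i\<in>{1..N}. indicator ?B (X i \<omega>))) / real N" for \<omega>
    unfolding sum_p using N_pos by (simp add: field_simps)
  then have "expectation (\<lambda>\<omega>. (measure ?L ?B - 1 / real N * (\<Sum>i=1..N. indicator ?B (X i \<omega>)))\<^sup>2)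
      = expectation (\<lambda>\<omega>. ((\<Sum>i\<in>{1..N}. p i) - (\<Sum>i\<in>{1..N}. indicator ?B (X i \<omega>)))\<^sup>2) / (real N)\<^sup>2"
    by (simp add: power_divide)
  also have "\<dots> = (\<Sum>i\<in>{1..N}. p i * (1 - p i)) / (real N)\<^sup>2"
    unfolding p_def by (subst expectation_square_count_error[OF _ indep B]) auto
  also have "(\<Sum>i\<in>{1..N}. p i * (1 - p i))
      = (\<Sum>i\<in>{1..N}. let p = real N * measure ?L (\<Omega> i \<inter> ?B) in p * (1 - p))"
    by (intro sum.cong refl) (simp add: p Let_def)
  also have "\<dots> / (real N)\<^sup>2 \<le> (real d * real m ^ (d - 1) + 2) / 4 / (real N)\<^sup>2"
    by (intro divide_right_mono sum_bernoulli_variances_le) simp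
  finally show ?thesis
    by simp
qed

end

section \<open>Exchange of expectation and integration\<close>

lemma measure_unit_cube: "measure (lborel_pow d) (unit_cube d) = 1"
  unfolding unit_cube_def by (subst measure_lborel_pow_PiE) auto

lemma unit_cube_fmeasurable: "unit_cube d \<in> fmeasurable (lborel_pow d)"
  unfolding unit_cube_def by (rule PiE_fmeasurable) auto

text \<open>
  Fubini's theorem exchanges the expectation with the integral over \<open>z\<close>, and the unit cube has volume
  \<open>1\<close>. The integrand is bounded, so the remaining point is its joint measurability in the sample
  and \<open>z\<close>.
\<close>

lemma expectation_L2_discrepancy_le:
  fixes X :: "nat \<Rightarrow> 'w \<Rightarrow> nat \<Rightarrow> real"
  assumes "prob_space M" and "N > 0"
    and X: "\<And>i. i \<in> {1..N} \<Longrightarrow> X i \<in> measurable M (lborel_pow d)"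
    and bound: "\<And>z. z \<in> unit_cube d \<Longrightarrow>
       prob_space.expectation M (\<lambda>\<omega>. (measure (lborel_pow d) (anchored_box d z)
            - 1 / real N * (\<Sum>i=1..N. indicator (anchored_box d z) (X i \<omega>)))\<^sup>2) \<le> C"
  shows "prob_space.expectation M (\<lambda>\<omega>. (L2_discrepancy d N (\<lambda>i. X i \<omega>))\<^sup>2) \<le> C"
proof -
  interpret prob_space M by fact
  interpret P: product_sigma_finite "\<lambda>_::nat. lborel :: real measure"
    by (rule product_sigma_finite_lborel)
  let ?L = "lborel_pow d"
  interpret L: sigma_finite_measure ?L
    by (rule P.sigma_finite) simp
  interpret pair_sigma_finite M ?L ..
  define g where "g \<omega> z = (measure ?L (anchored_box d z)
      - 1 / real N * (\<Sum>i=1..N. indicator (anchored_box d z) (X i \<omega>)))\<^sup>2" for \<omega> z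
  define f where "f \<omega> z = indicator (unit_cube d) z * g \<omega> z" for \<omega> z
  have cube: "unit_cube d \<in> sets ?L"
    using unit_cube_fmeasurable by auto
  have meas: "case_prod f \<in> borel_measurable (M \<Otimes>\<^sub>M ?L)"
  proof -
    \<comment> \<open>the integrand in coordinates: the volume becomes a product and membership in the box a finite conjunction, and both are visibly measurable in the pair\<close>
    define h where "h \<omega> z = indicator (unit_cube d) z * ((\<Prod>j\<in>{1..d}. z j)
      - 1 / real N * (\<Sum>i=1..N. if \<forall>j\<in>{1..d}. 0 \<le> X i \<omega> j \<and> X i \<omega> j < z j then 1 else 0))\<^sup>2" for \<omega> z
    have coord: "(\<lambda>x. x j) \<in> borel_measurable ?L" if "j \<in> {1..d}" for j
      using measurable_component_singleton[OF that, of "\<lambda>_. lborel :: real measure"] by simp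
    have Z: "(\<lambda>p. snd p j) \<in> borel_measurable (M \<Otimes>\<^sub>M ?L)" if "j \<in> {1..d}" for j
      by (rule measurable_compose[OF measurable_snd coord[OF that]])
    have XZ: "(\<lambda>p. X i (fst p) j) \<in> borel_measurable (M \<Otimes>\<^sub>M ?L)" if "i \<in> {1..N}" "j \<in> {1..d}" for i j
      by (rule measurable_compose[OF measurable_compose[OF measurable_fst X[OF that(1)]] coord[OF that(2)]])
    have "(\<lambda>p. h (fst p) (snd p)) \<in> borel_measurable (M \<Otimes>\<^sub>M ?L)"
      unfolding h_def
    proof (intro borel_measurable_times borel_measurable_power borel_measurable_diff
        borel_measurable_prod borel_measurable_sum borel_measurable_const Z)
      show "(\<lambda>p. indicator (unit_cube d) (snd p) :: real) \<in> borel_measurable (M \<Otimes>\<^sub>M ?L)"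
        by (rule measurable_compose[OF measurable_snd borel_measurable_indicator[OF cube]])
      fix i assume i: "i \<in> {1..N}"
      have "Measurable.pred (M \<Otimes>\<^sub>M ?L) (\<lambda>p. \<forall>j\<in>{1..d}. 0 \<le> X i (fst p) j \<and> X i (fst p) j < snd p j)"
      proof (rule pred_intros_finite(3))
        fix j assume j: "j \<in> {1..d}"
        note [measurable] = Z[OF j] XZ[OF i j]
        show "Measurable.pred (M \<Otimes>\<^sub>M ?L) (\<lambda>p. 0 \<le> X i (fst p) j \<and> X i (fst p) j < snd p j)"
          by measurable
      qed simp
      note [measurable] = this
      show "(\<lambda>p. if \<forall>j\<in>{1..d}. 0 \<le> X i (fst p) j \<and> X i (fst p) j < snd p j then 1 else 0 :: real)
          \<in> borel_measurable (M \<Otimes>\<^sub>M ?L)"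
        by measurable
    qed
    moreover have "h (fst p) (snd p) = f (fst p) (snd p)" if p: "p \<in> space (M \<Otimes>\<^sub>M ?L)" for p
    proof (cases "snd p \<in> unit_cube d")
      case True
      have "indicator (anchored_box d (snd p)) (X i (fst p))
          = (if \<forall>j\<in>{1..d}. 0 \<le> X i (fst p) j \<and> X i (fst p) j < snd p j then 1 else 0 :: real)"
        if i: "i \<in> {1..N}" for i
      proof -
        have "X i (fst p) \<in> space ?L"
          using measurable_space[OF X[OF i]] p by (auto simp: space_pair_measure)
        then have "X i (fst p) \<in> extensional {1..d}"
          by (simp add: space_PiM PiE_iff)
        then show ?thesis
          by (auto simp: anchored_box_def PiE_iff indicator_def)
      qed
      then show ?thesis
        unfolding h_def f_def g_def measure_anchored_box[OF True] by simp
    qed (simp add: h_def f_def)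
    ultimately have "(\<lambda>p. f (fst p) (snd p)) \<in> borel_measurable (M \<Otimes>\<^sub>M ?L)"
      using measurable_cong[of "M \<Otimes>\<^sub>M ?L" "\<lambda>p. h (fst p) (snd p)" "\<lambda>p. f (fst p) (snd p)"] by blast
    then show ?thesis
      by (simp add: case_prod_beta')
  qed
  have g_le: "g \<omega> z \<le> 1" if z: "z \<in> unit_cube d" for \<omega> z
  proof -
    have "0 \<le> measure ?L (anchored_box d z)" "measure ?L (anchored_box d z) \<le> 1"
      using z unfolding measure_anchored_box[OF z]
      by (auto intro!: prod_nonneg prod_le_1 simp: unit_cube_def PiE_iff)
    moreover have "(\<Sum>i=1..N. indicator (anchored_box d z) (X i \<omega>)) \<le> (\<Sum>i=1..N. 1::real)"
      by (intro sum_mono) (auto simp: indicator_def)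
    then have "0 \<le> 1 / real N * (\<Sum>i=1..N. indicator (anchored_box d z) (X i \<omega>))"
      "1 / real N * (\<Sum>i=1..N. indicator (anchored_box d z) (X i \<omega>)) \<le> 1"
      using \<open>N > 0\<close> by (auto intro!: sum_nonneg divide_nonneg_nonneg)
    ultimately have "\<bar>measure ?L (anchored_box d z)
        - 1 / real N * (\<Sum>i=1..N. indicator (anchored_box d z) (X i \<omega>))\<bar> \<le> 1"
      by linarith
    then show ?thesis
      unfolding g_def by (simp add: abs_square_le_1)
  qed
  have int: "integrable (M \<Otimes>\<^sub>M ?L) (case_prod f)"
  proof (rule integrableI_bounded_set[where A = "space M \<times> unit_cube d" and B = 1])
    show "space M \<times> unit_cube d \<in> sets (M \<Otimes>\<^sub>M ?L)"
      using cube by auto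
    have "emeasure (M \<Otimes>\<^sub>M ?L) (space M \<times> unit_cube d) = emeasure ?L (unit_cube d)"
      using cube by (subst L.emeasure_pair_measure_Times) (auto simp: emeasure_space_1)
    then show "emeasure (M \<Otimes>\<^sub>M ?L) (space M \<times> unit_cube d) < \<infinity>"
      using unit_cube_fmeasurable[of d] by (simp add: fmeasurable_def)
    show "AE x in M \<Otimes>\<^sub>M ?L. x \<in> space M \<times> unit_cube d \<longrightarrow> norm (case_prod f x) \<le> 1"
      using g_le by (auto simp: f_def g_def)
    show "AE x in M \<Otimes>\<^sub>M ?L. x \<notin> space M \<times> unit_cube d \<longrightarrow> case_prod f x = 0"
      by (rule AE_I2) (auto simp: f_def space_pair_measure split: split_indicator_asm)
  qed (rule meas)
  have L2: "(L2_discrepancy d N (\<lambda>i. X i \<omega>))\<^sup>2 = (\<integral>z. f \<omega> z \<partial>?L)" for \<omega>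
  proof -
    have "0 \<le> (\<integral>z. f \<omega> z \<partial>?L)"
      by (intro Bochner_Integration.integral_nonneg) (simp add: f_def g_def)
    then show ?thesis
      by (simp add: L2_discrepancy_def set_lebesgue_integral_def f_def g_def)
  qed
  have "expectation (\<lambda>\<omega>. (L2_discrepancy d N (\<lambda>i. X i \<omega>))\<^sup>2) = (\<integral>z. expectation (\<lambda>\<omega>. f \<omega> z) \<partial>?L)"
    unfolding L2 by (rule Fubini_integral[OF int, symmetric])
  also have "\<dots> \<le> (\<integral>z. indicator (unit_cube d) z * C \<partial>?L)"
  proof (rule integral_mono)
    show "integrable ?L (\<lambda>z. expectation (\<lambda>\<omega>. f \<omega> z))"
      by (rule integrable_snd[OF int])
    show "integrable ?L (\<lambda>z. indicator (unit_cube d) z * C)"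
      using unit_cube_fmeasurable[of d] by (simp add: fmeasurable_def)
    show "expectation (\<lambda>\<omega>. f \<omega> z) \<le> indicator (unit_cube d) z * C" for z
      using bound[of z] by (cases "z \<in> unit_cube d") (simp_all add: f_def g_def)
  qed
  also have "\<dots> = C"
    using measure_unit_cube[of d] cube by simp
  finally show ?thesis .
qed

section \<open>The bound on the mean square discrepancy\<close>

text \<open>
  In the first branch \<open>0 \<le> tan \<theta> \<le> 1 / 2\<close>, in the last \<open>0 \<le> cot \<theta> \<le> 2\<close>. Only the linear term is
  negative there, and it is smallest at \<open>tan \<theta> = 1 / 2\<close>, that is at \<open>cot \<theta> = 2\<close>, where both
  branches give \<open>- (1 / 12)\<close>.
\<close>

lemma P_theta_lower_bound:
  assumes "0 \<le> \<theta>" "\<theta> \<le> pi / 2"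
  shows "- (1 / 12) \<le> P_theta \<theta>"
proof -
  consider "\<theta> < arctan (1 / 2)" | "\<theta> = arctan (1 / 2)" | "\<theta> > arctan (1 / 2)"
    by linarith
  then show ?thesis
  proof cases
    case 1
    have "0 \<le> tan \<theta>" "tan \<theta> < tan (arctan (1 / 2))"
      using assms 1 arctan_ubound[of "1/2"] by (auto intro!: tan_pos_pi2_le tan_monotone)
    then have "0 \<le> tan \<theta> ^ 3" "0 \<le> tan \<theta> ^ 2" "tan \<theta> < 1 / 2"
      by (auto simp: tan_arctan)
    moreover have "P_theta \<theta> = 2 / 45 * tan \<theta> ^ 3 + 2 / 15 * tan \<theta> ^ 2 - tan \<theta> / 6"
      using 1 by (simp add: P_theta_def)
    ultimately show ?thesis
      by linarith
  next
    case 2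
    then show ?thesis
      by (simp add: P_theta_def)
  next
    case 3
    have "0 \<le> cot \<theta> \<and> cot \<theta> \<le> 2"
    proof (cases "\<theta> = pi / 2")
      case True
      then have "cos \<theta> = 0"
        by (simp only: cos_pi_half)
      then show ?thesis
        by (simp add: cot_def)
    next
      case False
      have "tan (arctan (1 / 2)) < tan \<theta>"
        using 3 False assms arctan_lbound[of "1/2"] by (intro tan_monotone) auto
      then have "1 / 2 < tan \<theta>"
        by (simp add: tan_arctan)
      moreover have "cot \<theta> = 1 / tan \<theta>"
        by (simp add: cot_def tan_def)
      ultimately show ?thesis
        by (simp add: divide_le_eq)
    qed
    moreover from this have "0 \<le> cot \<theta> ^ 2" "0 \<le> cot \<theta> ^ 3"
      by auto
    moreover have "P_theta \<theta> = - (1 / 24 * cot \<theta>) + 1 / 120 * cot \<theta> ^ 2 + 1 / 1440 * cot \<theta> ^ 3"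
      using 3 by (simp add: P_theta_def)
    ultimately show ?thesis
      by linarith
  qed
qed

theorem theorem3p5:
  fixes m d N :: nat and \<theta> :: real
    and \<Omega> :: "nat \<Rightarrow> (nat \<Rightarrow> real) set"
    and M :: "'w measure" and X :: "nat \<Rightarrow> 'w \<Rightarrow> nat \<Rightarrow> real"
  assumes "m \<ge> d" and "d \<ge> 2"
    and "0 \<le> \<theta>" and "\<theta> \<le> pi / 2"
    and "N = m ^ d"
    and "local_convex_partition m d \<theta> \<Omega>"
    and "stratified_points M d N \<Omega> X"
  shows "prob_space.expectation M (\<lambda>\<omega>. (L2_discrepancy d N (\<lambda>i. X i \<omega>))\<^sup>2)
           \<le> real d / real N powr (1 + 1 / real d)
             + 1 / real N ^ 3 * (1 / 3 ^ (d - 2)) * P_theta \<theta>"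
proof -
  have m: "m \<ge> 2"
    using assms by simp
  interpret prob_space M
    using assms by (simp add: stratified_points_def)
  have N_pos: "N > 0"
    using m assms by simp
  have Nm: "real N powr (1 + 1 / real d) = real N * real m"
  proof -
    have "real N powr (1 / real d) = (real m powr real d) powr (1 / real d)"
      using m assms by (simp add: powr_realpow)
    also have "\<dots> = real m"
      using m assms by (simp add: powr_powr)
    finally show ?thesis
      using N_pos by (simp add: powr_add)
  qed
  have "X i \<in> measurable M (lborel_pow d)" if "i \<in> {1..N}" for i
    using assms(7) that unfolding stratified_points_def indep_vars_def by blast
  then have "expectation (\<lambda>\<omega>. (L2_discrepancy d N (\<lambda>i. X i \<omega>))\<^sup>2)
      \<le> (real d * real m ^ (d - 1) + 2) / (4 * (real N)\<^sup>2)"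
    using m assms N_pos
    by (intro expectation_L2_discrepancy_le expectation_local_discrepancy_le) (auto intro: prob_space_axioms)
  also have "\<dots> \<le> 3 / 8 * (real d / (real N * real m))"
  proof -
    have power: "real N = real m * real m ^ (d - 1)"
      using assms by (cases d) simp_all
    \<comment> \<open>the constant 2 from the convex parts is at most half of the bound \<open>d m ^ (d - 1)\<close> on the number of cut cubes, which is at least 4\<close>
    have "2 \<le> real m ^ (d - 1)"
    proof -
      have "real m ^ 1 \<le> real m ^ (d - 1)"
        using m assms by (intro power_increasing) auto
      then show ?thesis
        using m unfolding power_one_right by linarith
    qed
    then have "2 * 2 \<le> real d * real m ^ (d - 1)"
      using assms by (intro mult_mono) auto
    then have "(real d * real m ^ (d - 1) + 2) / (4 * (real N)\<^sup>2)
        \<le> (3 / 2 * (real d * real m ^ (d - 1))) / (4 * (real N)\<^sup>2)"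
      by (intro divide_right_mono) auto
    also have "\<dots> = 3 / 8 * (real d / (real N * real m))"
      using m unfolding power by (simp add: power2_eq_square)
    finally show ?thesis .
  qed
  also have "\<dots> \<le> real d / (real N * real m) - 1 / 12 * (1 / (real N * real m))"
  proof -
    \<comment> \<open>5/8 of the first-order term is left over, and the correction term takes at most 1/12 of its unit \<open>1 / (N m)\<close>\<close>
    have "1 / 12 * (1 / (real N * real m)) \<le> 5 / 8 * real d * (1 / (real N * real m))"
      using assms by (intro mult_right_mono) auto
    then show ?thesis
      by (simp add: field_simps)
  qed
  also have "\<dots> \<le> real d / (real N * real m) + 1 / real N ^ 3 * (1 / 3 ^ (d - 2)) * P_theta \<theta>"
  proof -
    define c where "c = 1 / real N ^ 3 * (1 / 3 ^ (d - 2))"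
    have "m \<le> N"
      using self_le_power[of m d] m assms by simp
    then have "real N * real m * 1 \<le> real N * real N * real N"
      using N_pos by (intro mult_mono) auto
    then have "1 / real N ^ 3 \<le> 1 / (real N * real m)"
      using N_pos m by (intro divide_left_mono) (auto simp: power3_eq_cube)
    moreover have "1 / real N ^ 3 * (1 / 3 ^ (d - 2)) \<le> 1 / real N ^ 3 * 1"
      by (intro mult_left_mono) auto
    ultimately have "0 \<le> c" "c \<le> 1 / (real N * real m)"
      by (auto simp: c_def)
    moreover from \<open>0 \<le> c\<close> have "c * - (1 / 12) \<le> c * P_theta \<theta>"
      by (intro mult_left_mono P_theta_lower_bound[OF assms(3,4)])
    ultimately show ?thesis
      unfolding c_def[symmetric] by linarith
  qed
  finally show ?thesis
    unfolding Nm .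
qed

end
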